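(* Let $d=2k$ with $k\ge2$ an integer. Then the following $(d,\Pi)$ is exceptional for branched covers $\mathbb S^2\to\mathbb S^2$: $$\Pi=[(k_1,k_2),\ \underbrace{(2,\dots,2)}_{k},\ \underbrace{(2,\dots,2)}_{k}],$$ where $k_1,k_2$ are positive integers with $k_1+k_2=2k$ and $k_1\ne k_2$. If in addition $k\ge3$, then the following $(d,\Pi)$ is also exceptional: $$\Pi=[\underbrace{(2,\dots,2)}_{k},\ (\underbrace{2,\dots,2}_{j_1},\,2k-2j_1),\ (\underbrace{2,\dots,2}_{j_2},\,2k-2j_2)],$$ where $j_1,j_2$ are integers with $j_1+j_2=k$, $j_1\ne j_2$ and $j_1,j_2\ge1$.
   Context: A branched cover $f:\mathbb S^2\to\mathbb S^2$ of degree $d$ is a non-constant holomorphic map of the Riemann sphere of degree $d$. Near each point $q$ of the source it has, in suitable local holomorphic coordinates, the form $z\mapsto z^{e_q}$, where $e_q\in\mathbb N$ is the local ramification index. The branching points are the images of the points with $e_q\ge2$. A candidate branch datum $(d,\Pi)$ consists of $d\in\mathbb N$ and a list of $n$ tuples of positive integers $\Pi=[(\Pi_1^1,\dots,\Pi_1^{\ell_1}),\dots,(\Pi_n^1,\dots,\Pi_n^{\ell_n})]$ such that for each $i$ at least one $\Pi_i^j\ge2$, $\sum_j\Pi_i^j=d$ for each $i$, and $2=2d-\sum_{i=1}^n\sum_{j=1}^{\ell_i}(\Pi_i^j-1)$ (Riemann–Hurwitz). It is realized by a branched cover $f:\mathbb S^2\to\mathbb S^2$ of degree $d$ if $f$ has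 exactly $n$ distinct branching points $p_1,\dots,p_n$ and, for each $i$, the preimage $f^{-1}(p_i)$ consists of $\ell_i$ points with local ramification indices $\Pi_i^1,\dots,\Pi_i^{\ell_i}$ (up to order). The datum is exceptional if it is a candidate branch datum that is not realized by any branched cover $\mathbb S^2\to\mathbb S^2$. An underbrace with a number indicates how many entries are in the underbraced list. *)

theory Defs
  imports "HOL-Complex_Analysis.Complex_Analysis"
begin

text \<open>The Riemann sphere has underlying type \<^typ>\<open>complex option\<close>, with \<^term>\<open>None\<close> as the point
  at infinity and the topology of the one-point compactification of the complex plane.\<close>

definition riemann_sphere :: "complex option topology" where
  "riemann_sphere = Alexandroff_compactification euclidean"

definition infinity_param :: "complex \<Rightarrow> complex option" where
  "infinity_param w = (if w = 0 then None else Some (inverse w))"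

text \<open>The inverses of the two standard charts \<open>z\<close> and \<open>1/z\<close>. Both parametrizations are
  injective on all of the complex plane; their ranges cover the sphere.\<close>

definition sphere_params :: "(complex \<Rightarrow> complex option) set" where
  "sphere_params = {Some, infinity_param}"

text \<open>Local expressions are written \<open>inv \<psi> \<circ> f \<circ> \<phi>\<close>; \<open>inv \<psi>\<close> is meaningful only on the range of
  \<open>\<psi>\<close>, hence the restriction of the domain.\<close>

definition holomorphic_sphere_map :: "(complex option \<Rightarrow> complex option) \<Rightarrow> bool" where
  "holomorphic_sphere_map f \<longleftrightarrow>
     continuous_map riemann_sphere riemann_sphere f \<and>
     (\<forall>\<phi>\<in>sphere_params. \<forall>\<psi>\<in>sphere_params.
        (inv \<psi> \<circ> f \<circ> \<phi>) holomorphic_on {z. f (\<phi> z) \<in> range \<psi>})"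

text \<open>A local holomorphic coordinate on \<open>U\<close>, centred at \<open>q\<close>. An injective holomorphic function
  is automatically biholomorphic onto its open image.\<close>

definition local_coordinate ::
  "complex option \<Rightarrow> complex option set \<Rightarrow> (complex option \<Rightarrow> complex) \<Rightarrow> bool" where
  "local_coordinate q U g \<longleftrightarrow>
     openin riemann_sphere U \<and> q \<in> U \<and> g q = 0 \<and> inj_on g U \<and>
     (\<forall>\<phi>\<in>sphere_params. (g \<circ> \<phi>) holomorphic_on (\<phi> -` U))"

text \<open>In suitable local coordinates centred at \<open>q\<close> and \<open>f q\<close>, the map \<open>f\<close> is \<open>z \<mapsto> z ^ e\<close>.
  The case \<open>e = 0\<close> is impossible, since both coordinates vanish at their centres.\<close>

definition has_ramification_index ::
  "(complex option \<Rightarrow> complex option) \<Rightarrow> complex option \<Rightarrow> nat \<Rightarrow> bool" where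
  "has_ramification_index f q e \<longleftrightarrow>
     (\<exists>U g V h. local_coordinate q U g \<and> local_coordinate (f q) V h \<and>
        f ` U \<subseteq> V \<and> (\<forall>x\<in>U. h (f x) = g x ^ e))"

definition branching_points :: "(complex option \<Rightarrow> complex option) \<Rightarrow> complex option set" where
  "branching_points f = {f q | q e. has_ramification_index f q e \<and> e \<ge> 2}"

text \<open>The degree is the number of preimages of any point that is not a branching point.\<close>

definition branched_cover :: "(complex option \<Rightarrow> complex option) \<Rightarrow> nat \<Rightarrow> bool" where
  "branched_cover f d \<longleftrightarrow>
     holomorphic_sphere_map f \<and> \<not> f constant_on UNIV \<and>
     (\<forall>p. p \<notin> branching_points f \<longrightarrow> finite (f -` {p}) \<and> card (f -` {p}) = d)"

definition candidate_branch_datum :: "nat \<Rightarrow> nat list list \<Rightarrow> bool" where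
  "candidate_branch_datum d P \<longleftrightarrow>
     (\<forall>\<pi>\<in>set P. (\<forall>e\<in>set \<pi>. e \<ge> 1) \<and> (\<exists>e\<in>set \<pi>. e \<ge> 2) \<and> sum_list \<pi> = d) \<and>
     2 = 2 * int d - (\<Sum>\<pi>\<leftarrow>P. \<Sum>e\<leftarrow>\<pi>. (int e - 1))"

text \<open>The branching points are listed without repetition in the order of \<open>P\<close>; the enumeration
  \<open>qs\<close> of each fibre is arbitrary, so indices are compared up to order.\<close>

definition realizes :: "(complex option \<Rightarrow> complex option) \<Rightarrow> nat \<Rightarrow> nat list list \<Rightarrow> bool" where
  "realizes f d P \<longleftrightarrow>
     branched_cover f d \<and>
     (\<exists>ps. length ps = length P \<and> distinct ps \<and> set ps = branching_points f \<and>
        (\<forall>i<length P. \<exists>qs. distinct qs \<and> set qs = f -` {ps ! i} \<and>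
           list_all2 (has_ramification_index f) qs (P ! i)))"

definition exceptional :: "nat \<Rightarrow> nat list list \<Rightarrow> bool" where
  "exceptional d P \<longleftrightarrow> candidate_branch_datum d P \<and> \<not> (\<exists>f. realizes f d P)"

end

theory Submission
  imports Defs
begin

text \<open>
  Both data contain two partitions of \<open>2 k\<close> with only even parts. This forces the map to be a square
  and thereby bounds all indices over the third point by \<open>k\<close>.

  Indeed, let \<open>f\<close> have only even indices over two points \<open>p \<noteq> q\<close>, with sum \<open>2 k\<close> over each. After a
  Moebius transformation of the target, \<open>p = 0\<close> and \<open>q = \<infinity>\<close>; then all zeros and poles of \<open>f\<close> have even
  order, so \<open>f = c g\<^sup>2\<close> for a rational map \<open>g\<close> of degree \<open>k\<close>. Squaring is unramified outside \<open>0\<close> and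
  \<open>\<infinity>\<close>, so at every point \<open>x\<close> over a third value the index of \<open>f\<close> is the index of \<open>g\<close>, which
  cannot exceed the degree \<open>k\<close>. This is the lemma \<open>ramification_index_in_complement\<close>.

  For \<open>[(k1, k2), (2, \<dots>, 2), (2, \<dots>, 2)]\<close> it gives \<open>k1 \<le> k\<close> and \<open>k2 \<le> k\<close>, so \<open>k1 = k2\<close> because
  \<open>k1 + k2 = 2 k\<close>. In the second family \<open>2 k - 2 j1 = 2 j2\<close> and \<open>2 k - 2 j2 = 2 j1\<close>, so all three
  partitions are even. Pairing the first with each of the others gives \<open>2 j1 \<le> k\<close> and \<open>2 j2 \<le> k\<close>, so
  \<open>j1 = j2\<close>.

  The argument is carried out with \<open>x\<close> at infinity. Write \<open>F\<close> for \<open>f\<close> in Moebius coordinates of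
  source and target. Then \<open>F = c (P / Q)\<^sup>2\<close> with monic polynomials \<open>P\<close>, \<open>Q\<close> of degree \<open>k\<close>
  (\<open>square_of_rational_function\<close>, by Liouville's theorem), and \<open>F - c = c (P - Q) (P + Q) / Q\<^sup>2\<close> cannot
  decay faster than \<open>z\<^sup>-\<^sup>k\<close> (\<open>square_of_rational_function_order_at_infinity\<close>). Ramification indices enter
  only as orders of vanishing, which do not depend on the local coordinates in which they are measured
  (\<open>ramification_index_limit\<close>).
\<close>

section \<open>Squares of rational functions\<close>

lemma eventually_at_infinity_notin_finite:
  fixes S :: "complex set"
  assumes "finite S"
  shows "eventually (\<lambda>z. z \<notin> S) at_infinity"
proof -
  obtain b where "\<And>z. z \<in> S \<Longrightarrow> norm z \<le> b"
    using finite_imp_bounded[OF assms] bounded_iff by blast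
  then show ?thesis
    unfolding eventually_at_infinity by (intro exI[of _ "b + 1"]) force
qed

text \<open>A function rather than an element of a polynomial type, since only its holomorphy and its limits
  at single points and at infinity matter. Below, \<open>m\<close> is half of the order of a zero or a pole.\<close>

definition divisor_poly :: "complex set \<Rightarrow> (complex \<Rightarrow> nat) \<Rightarrow> complex \<Rightarrow> complex" where
  "divisor_poly A m z = (\<Prod>a\<in>A. (z - a) ^ m a)"

lemma divisor_poly_holomorphic: "divisor_poly A m holomorphic_on S"
  unfolding divisor_poly_def by (intro holomorphic_intros)

lemma divisor_poly_tendsto: "(divisor_poly A m \<longlongrightarrow> divisor_poly A m z) (at z)"
  unfolding divisor_poly_def by (intro tendsto_intros)

lemma divisor_poly_nonzero: "finite A \<Longrightarrow> z \<notin> A \<Longrightarrow> divisor_poly A m z \<noteq> 0"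
  by (auto simp: divisor_poly_def)

lemma divisor_poly_remove:
  "finite A \<Longrightarrow> a \<in> A \<Longrightarrow> divisor_poly A m z = (z - a) ^ m a * divisor_poly (A - {a}) m z"
  by (simp add: divisor_poly_def prod.remove)

lemma divisor_poly_monic_at_infinity:
  assumes "finite A"
  shows "((\<lambda>z. divisor_poly A m z / z ^ (\<Sum>a\<in>A. m a)) \<longlongrightarrow> 1) at_infinity"
proof -
  have lin: "((\<lambda>z. 1 - a * inverse z) \<longlongrightarrow> 1 - a * 0) at_infinity" for a :: complex
    by (intro tendsto_intros tendsto_inverse_0)
  have "((\<lambda>z. \<Prod>a\<in>A. (1 - a * inverse z) ^ m a) \<longlongrightarrow> (\<Prod>a\<in>A. (1 - a * 0) ^ m a)) at_infinity"
    by (intro tendsto_intros lin)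
  moreover have "eventually (\<lambda>z. (\<Prod>a\<in>A. (1 - a * inverse z) ^ m a) =
      divisor_poly A m z / z ^ (\<Sum>a\<in>A. m a)) at_infinity"
    using eventually_at_infinity_notin_finite[of "{0}", simplified]
  proof eventually_elim
    case (elim z)
    have "1 - a * inverse z = (z - a) / z" for a
      using elim by (simp add: field_simps)
    then show ?case
      by (simp only: divisor_poly_def power_sum power_divide prod_dividef)
  qed
  ultimately show ?thesis
    by (simp add: Lim_transform_eventually)
qed

text \<open>The Liouville argument behind the factorization through squaring. Let \<open>P\<close>, \<open>Q\<close> be the monic
  polynomials of equal degree that collect half of every zero and half of every pole of \<open>F\<close>. In
  \<open>F Q\<^sup>2 / P\<^sup>2\<close> all zeros and poles cancel, so it extends to an entire function, and it has the limit
  \<open>c\<close> at infinity because \<open>Q / P\<close> tends to \<open>1\<close>; hence it is the constant \<open>c\<close>.\<close>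

lemma square_of_rational_function:
  fixes F :: "complex \<Rightarrow> complex"
  assumes fin: "finite A" "finite B"
    and deg: "(\<Sum>a\<in>A. m a) = k" "(\<Sum>b\<in>B. n b) = k"
    and hol: "F holomorphic_on - (A \<union> B)"
    and zeros: "\<And>a. a \<in> A \<Longrightarrow> \<exists>l. ((\<lambda>z. F z / (z - a) ^ (2 * m a)) \<longlongrightarrow> l) (at a)"
    and poles: "\<And>b. b \<in> B \<Longrightarrow> \<exists>l. ((\<lambda>z. F z * (z - b) ^ (2 * n b)) \<longlongrightarrow> l) (at b)"
    and lim: "(F \<longlongrightarrow> c) at_infinity"
    and z: "z \<notin> A \<union> B"
  shows "F z = c * (divisor_poly A m z / divisor_poly B n z)\<^sup>2"
proof -
  define P where "P = divisor_poly A m"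
  define Q where "Q = divisor_poly B n"
  define G where "G z = F z * (Q z / P z)\<^sup>2" for z
  have P0: "P z \<noteq> 0" if "z \<notin> A" for z
    using that fin divisor_poly_nonzero by (simp add: P_def)
  have Q0: "Q z \<noteq> 0" if "z \<notin> B" for z
    using that fin divisor_poly_nonzero by (simp add: Q_def)
  have limits: "\<exists>l. (G \<longlongrightarrow> l) (at z)" if "z \<in> A \<union> B" for z
  proof (cases "z \<in> A")
    case True
    define P' where "P' = divisor_poly (A - {z}) m"
    have P': "P' z \<noteq> 0"
      using fin by (simp add: P'_def divisor_poly_nonzero)
    obtain l where "((\<lambda>w. F w / (w - z) ^ (2 * m z)) \<longlongrightarrow> l) (at z)"
      using zeros True by blast
    then have "((\<lambda>w. F w / (w - z) ^ (2 * m z) * (Q w / P' w)\<^sup>2) \<longlongrightarrow> l * (Q z / P' z)\<^sup>2) (at z)"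
      using P' unfolding Q_def P'_def by (intro tendsto_intros divisor_poly_tendsto)
    moreover have "(\<lambda>w. F w / (w - z) ^ (2 * m z) * (Q w / P' w)\<^sup>2) = G"
      using divisor_poly_remove[OF fin(1) True]
      by (auto simp: G_def P_def P'_def fun_eq_iff power_mult_distrib power_divide
          simp flip: power_mult simp: mult.commute)
    ultimately show ?thesis by auto
  next
    case False
    then have zB: "z \<in> B" using that by simp
    define Q' where "Q' = divisor_poly (B - {z}) n"
    obtain l where "((\<lambda>w. F w * (w - z) ^ (2 * n z)) \<longlongrightarrow> l) (at z)"
      using poles zB by blast
    then have "((\<lambda>w. F w * (w - z) ^ (2 * n z) * (Q' w / P w)\<^sup>2) \<longlongrightarrow> l * (Q' z / P z)\<^sup>2) (at z)"
      using P0[OF False] unfolding P_def Q'_def by (intro tendsto_intros divisor_poly_tendsto)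
    moreover have "(\<lambda>w. F w * (w - z) ^ (2 * n z) * (Q' w / P w)\<^sup>2) = G"
      using divisor_poly_remove[OF fin(2) zB]
      by (auto simp: G_def Q_def Q'_def fun_eq_iff power_mult_distrib power_divide
          simp flip: power_mult simp: mult.commute)
    ultimately show ?thesis by auto
  qed
  then obtain l where l: "\<And>z. z \<in> A \<union> B \<Longrightarrow> (G \<longlongrightarrow> l z) (at z)"
    by metis
  \<comment> \<open>The values at the punctures are the limits of \<open>G\<close>, so the singularities become removable.\<close>
  define H where "H z = (if z \<in> A \<union> B then l z else G z)" for z
  have HG: "eventually (\<lambda>w. G w = H w) (at z)" for z
  proof -
    have "open (- (A \<union> B - {z}))"
      using fin by (intro open_Compl finite_imp_closed) auto
    then have "eventually (\<lambda>w. w \<in> - (A \<union> B - {z})) (at z)"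
      by (intro eventually_at_in_open') auto
    moreover have "eventually (\<lambda>w. w \<noteq> z) (at z)"
      by (simp add: eventually_at_filter)
    ultimately show ?thesis
      by eventually_elim (auto simp: H_def)
  qed
  have "H holomorphic_on UNIV"
  proof (rule no_isolated_singularity'[where K = "A \<union> B"])
    show "(H \<longlongrightarrow> H z) (at z within UNIV)" if "z \<in> A \<union> B" for z
    proof -
      have "H z = l z" using that by (simp add: H_def)
      then show ?thesis using Lim_transform_eventually[OF l[OF that] HG] by simp
    qed
    have "G holomorphic_on - (A \<union> B)"
      unfolding G_def using P0 hol
      by (auto intro!: holomorphic_intros divisor_poly_holomorphic simp: P_def Q_def)
    then show "H holomorphic_on UNIV - (A \<union> B)"
      by (rule holomorphic_transform[OF holomorphic_on_subset]) (auto simp: H_def)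
  qed (use fin in auto)
  moreover have "(H \<longlongrightarrow> c) at_infinity"
  proof -
    have "((\<lambda>z. F z * ((Q z / z ^ k) / (P z / z ^ k))\<^sup>2) \<longlongrightarrow> c * (1 / 1)\<^sup>2) at_infinity"
      using divisor_poly_monic_at_infinity[OF fin(1), of m]
        divisor_poly_monic_at_infinity[OF fin(2), of n]
      unfolding deg P_def Q_def by (intro tendsto_intros lim) auto
    moreover have "eventually (\<lambda>z. F z * ((Q z / z ^ k) / (P z / z ^ k))\<^sup>2 = H z) at_infinity"
      using eventually_at_infinity_notin_finite[of "insert 0 (A \<union> B)"] fin
      by (auto elim!: eventually_mono simp: H_def G_def)
    ultimately show ?thesis
      by (auto elim: Lim_transform_eventually)
  qed
  ultimately have "H z = c" by (rule Liouville_weak)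
  then show ?thesis
    using z P0[of z] Q0[of z] by (auto simp: H_def G_def P_def Q_def field_simps)
qed

text \<open>In \<open>F - c = c (P - Q) (P + Q) / Q\<^sup>2\<close> the factor \<open>(P + Q) / Q\<^sup>2\<close> decays exactly like
  \<open>z\<^sup>-\<^sup>k\<close>, since \<open>P\<close> and \<open>Q\<close> are monic of degree \<open>k\<close>. If \<open>F - c\<close> decayed faster, the entire function
  \<open>P - Q\<close> would tend to \<open>0\<close> at infinity and vanish by Liouville's theorem, so \<open>F\<close> would be
  constant. In terms of \<open>g = P / Q\<close>, this says that the map \<open>g\<close> of degree \<open>k\<close> takes the value \<open>1\<close> at
  infinity with multiplicity at most \<open>k\<close>.\<close>

lemma square_of_rational_function_order_at_infinity:
  fixes F :: "complex \<Rightarrow> complex"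
  assumes fin: "finite A" "finite B"
    and deg: "(\<Sum>a\<in>A. m a) = k" "(\<Sum>b\<in>B. n b) = k"
    and F: "\<And>z. z \<notin> A \<union> B \<Longrightarrow> F z = c * (divisor_poly A m z / divisor_poly B n z)\<^sup>2"
    and "c \<noteq> 0" "L \<noteq> 0"
    and order: "((\<lambda>z. (F z - c) * z ^ e) \<longlongrightarrow> L) at_infinity"
  shows "e \<le> k"
proof (rule ccontr)
  assume "\<not> e \<le> k"
  then have ek: "e = k + (e - k)" "e - k > 0" by auto
  define P where "P = divisor_poly A m"
  define Q where "Q = divisor_poly B n"
  have P1: "((\<lambda>z. P z / z ^ k) \<longlongrightarrow> 1) at_infinity" and Q1: "((\<lambda>z. Q z / z ^ k) \<longlongrightarrow> 1) at_infinity"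
    using divisor_poly_monic_at_infinity[OF fin(1), of m]
      divisor_poly_monic_at_infinity[OF fin(2), of n] unfolding deg P_def Q_def by auto
  have nz: "eventually (\<lambda>z. P z / z ^ k + Q z / z ^ k \<noteq> 0) at_infinity"
    by (rule tendsto_imp_eventually_ne[OF tendsto_add[OF P1 Q1]]) simp
  have generic: "eventually (\<lambda>z. z \<noteq> 0 \<and> z \<notin> A \<union> B) at_infinity"
    using eventually_at_infinity_notin_finite[of "insert 0 (A \<union> B)"] fin by auto
  \<comment> \<open>Solving \<open>F - c = c (P - Q) (P + Q) / Q\<^sup>2\<close> for \<open>P - Q\<close> expresses it through factors with known
    limits, one of which, \<open>1 / z ^ (e - k)\<close>, tends to \<open>0\<close>.\<close>
  have "((\<lambda>z. (F z - c) * z ^ e * (Q z / z ^ k)\<^sup>2 / (c * (P z / z ^ k + Q z / z ^ k))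
      * inverse z ^ (e - k)) \<longlongrightarrow> L * 1\<^sup>2 / (c * (1 + 1)) * 0 ^ (e - k)) at_infinity"
    using \<open>c \<noteq> 0\<close> by (intro tendsto_intros order P1 Q1 tendsto_inverse_0) auto
  moreover have "eventually (\<lambda>z. (F z - c) * z ^ e * (Q z / z ^ k)\<^sup>2 /
      (c * (P z / z ^ k + Q z / z ^ k)) * inverse z ^ (e - k) = P z - Q z) at_infinity"
    using nz generic
  proof eventually_elim
    case (elim z)
    have Q0: "Q z \<noteq> 0"
      using elim fin by (auto simp: Q_def divisor_poly_nonzero)
    have "F z - c = c * (P z - Q z) * (P z + Q z) / (Q z)\<^sup>2"
      using elim Q0 by (simp add: F flip: P_def Q_def) (simp add: field_simps power2_eq_square)
    moreover have "P z + Q z \<noteq> 0"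
      using elim(1) by (auto simp flip: add_divide_distrib)
    moreover have "z ^ e = z ^ k * z ^ (e - k)"
      using ek(1) by (metis power_add)
    ultimately show ?case
      using elim Q0 \<open>c \<noteq> 0\<close>
      by (simp add: power_inverse add_divide_distrib[symmetric]) (simp add: field_simps power2_eq_square)
  qed
  ultimately have "((\<lambda>z. P z - Q z) \<longlongrightarrow> L * 1\<^sup>2 / (c * (1 + 1)) * 0 ^ (e - k)) at_infinity"
    by (rule Lim_transform_eventually)
  then have "((\<lambda>z. P z - Q z) \<longlongrightarrow> 0) at_infinity"
    using ek(2) by (simp add: zero_power)
  then have "P z - Q z = 0" for z
    by (rule Liouville_weak[rotated])
      (auto intro!: holomorphic_intros divisor_poly_holomorphic simp: P_def Q_def)
  then have "P = Q" by (auto simp: fun_eq_iff)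
  then have "eventually (\<lambda>z. 0 = (F z - c) * z ^ e) at_infinity"
    using eventually_mono[OF generic] by (auto simp: F P_def Q_def fin divisor_poly_nonzero)
  then have "((\<lambda>z. (F z - c) * z ^ e) \<longlongrightarrow> 0) at_infinity"
    by (auto intro: Lim_transform_eventually[OF tendsto_const])
  then show False
    using tendsto_unique[OF _ order] \<open>L \<noteq> 0\<close> by (simp add: trivial_limit_at_infinity)
qed

section \<open>Charts and local coordinates on the Riemann sphere\<close>

lemma open_inverse_preimage:
  fixes V :: "complex set"
  assumes "open V"
  shows "open (- {0} \<inter> inverse -` V)"
  by (intro continuous_open_preimage continuous_intros assms) auto

text \<open>The one-point compactification carries the topology glued from the two standard charts. This
  description replaces compact complements by the chart \<open>1 / z\<close>.\<close>

lemma openin_riemann_sphere_iff: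
  "openin riemann_sphere U \<longleftrightarrow> open (Some -` U) \<and> open (infinity_param -` U)"
proof
  assume "openin riemann_sphere U"
  then consider V where "open V" "U = Some ` V"
    | C where "compact C" "U = insert None (Some ` (- C))"
    by (auto simp: riemann_sphere_def openin_Alexandroff_compactification Compl_eq_Diff_UNIV)
  then show "open (Some -` U) \<and> open (infinity_param -` U)"
  proof cases
    case 1
    have "infinity_param -` U = - {0} \<inter> inverse -` V"
      using 1 by (auto simp: infinity_param_def split: if_splits)
    then show ?thesis
      using 1 open_inverse_preimage[of V] by (simp add: inj_vimage_image_eq)
  next
    case 2
    obtain b where b: "b > 0" "\<And>z. z \<in> C \<Longrightarrow> norm z \<le> b"
      using compact_imp_bounded[OF 2(1)] by (metis bounded_pos)
    have "infinity_param w \<in> U" if "w \<in> ball 0 (inverse b)" for w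
    proof (cases "w = 0")
      case False
      then have "norm (inverse w) > b"
        using that b(1) by (simp add: norm_divide field_simps)
      then have "inverse w \<notin> C" using b(2) by fastforce
      then show ?thesis using 2 False by (auto simp: infinity_param_def)
    qed (use 2 in \<open>auto simp: infinity_param_def\<close>)
    then have "infinity_param -` U = (- {0} \<inter> inverse -` (- C)) \<union> ball 0 (inverse b)"
      using 2 b(1) by (auto simp: infinity_param_def split: if_splits)
    moreover have "Some -` U = - C" using 2 by auto
    moreover have "open (- C)" using 2 compact_imp_closed by blast
    ultimately show ?thesis using open_inverse_preimage by auto
  qed
next
  assume U: "open (Some -` U) \<and> open (infinity_param -` U)"
  show "openin riemann_sphere U"
  proof (cases "None \<in> U")
    case False
    then have "U = Some ` (Some -` U)"
      by (auto simp: image_iff) (metis not_None_eq)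
    then show ?thesis
      using U unfolding riemann_sphere_def openin_Alexandroff_compactification by auto
  next
    case True
    define C where "C = - (Some -` U)"
    have "0 \<in> infinity_param -` U" using True by (simp add: infinity_param_def)
    then obtain r where r: "r > 0" "ball 0 r \<subseteq> infinity_param -` U"
      using U open_contains_ball by blast
    have "norm z \<le> inverse r" if "z \<in> C" for z
    proof (rule ccontr)
      assume "\<not> norm z \<le> inverse r"
      then have z: "norm z > inverse r" by simp
      with r(1) have "z \<noteq> 0" by (metis inverse_positive_iff_positive norm_zero not_less_iff_gr_or_eq)
      then have "norm (inverse z) < r"
        using z r(1) by (simp add: norm_divide field_simps)
      then have "infinity_param (inverse z) \<in> U" using r by auto
      then show False using that \<open>z \<noteq> 0\<close> by (simp add: infinity_param_def C_def)
    qed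
    then have "bounded C" by (auto simp: bounded_iff)
    moreover have "closed C" using U by (simp add: C_def closed_def)
    ultimately have "compact C" by (simp add: compact_eq_bounded_closed)
    moreover have "U = insert None (Some ` (UNIV - C))"
      using True by (auto simp: C_def image_iff)
    ultimately show ?thesis
      using \<open>closed C\<close> unfolding riemann_sphere_def openin_Alexandroff_compactification by auto
  qed
qed

lemma topspace_riemann_sphere [simp]: "topspace riemann_sphere = UNIV"
  using notin_range_Some by (auto simp: riemann_sphere_def)

lemma inj_sphere_param: "\<phi> \<in> sphere_params \<Longrightarrow> inj \<phi>"
  by (auto simp: sphere_params_def inj_def infinity_param_def split: if_splits)

lemma in_range_sphere_param: "\<exists>\<phi>\<in>sphere_params. y \<in> range \<phi>"
proof (cases y)
  case None
  then have "y = infinity_param 0" by (simp add: infinity_param_def)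
  then show ?thesis by (auto simp: sphere_params_def)
qed (auto simp: sphere_params_def)

lemma open_sphere_param_preimage:
  "\<phi> \<in> sphere_params \<Longrightarrow> openin riemann_sphere U \<Longrightarrow> open (\<phi> -` U)"
  by (auto simp: sphere_params_def openin_riemann_sphere_iff)

lemma openin_sphere_param_image:
  assumes "\<phi> \<in> sphere_params" "open W"
  shows "openin riemann_sphere (\<phi> ` W)"
proof -
  have "Some -` (infinity_param ` W) = - {0} \<inter> inverse -` W"
    by (force simp: infinity_param_def image_iff split: if_splits)
  moreover have "infinity_param -` (Some ` W) = - {0} \<inter> inverse -` W"
    by (auto simp: infinity_param_def split: if_splits)
  ultimately show ?thesis
    using assms open_inverse_preimage[of W] inj_sphere_param[of infinity_param]
    by (auto simp: sphere_params_def openin_riemann_sphere_iff inj_vimage_image_eq)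
qed

lemma openin_sphere_delete: "openin riemann_sphere (- {q})"
proof -
  have "open (\<phi> -` (- {q}))" if "\<phi> \<in> sphere_params" for \<phi>
    using finite_vimageI[OF _ inj_sphere_param[OF that], of "{q}"]
    by (auto simp: vimage_Compl intro: finite_imp_closed)
  then show ?thesis by (simp add: openin_riemann_sphere_iff sphere_params_def)
qed

text \<open>The charts are homeomorphisms onto their open ranges, stated for limits along an arbitrary
  filter so that approach to a finite point and to infinity are covered at once.\<close>

lemma limitin_sphere_param:
  assumes \<phi>: "\<phi> \<in> sphere_params" and t: "limitin riemann_sphere t (\<phi> w) Fl"
  shows "eventually (\<lambda>s. t s \<in> range \<phi>) Fl" and "((\<lambda>s. inv \<phi> (t s)) \<longlongrightarrow> w) Fl"
proof -
  have ev: "eventually (\<lambda>s. t s \<in> \<phi> ` W) Fl" if "open W" "w \<in> W" for W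
    using t openin_sphere_param_image[OF \<phi> that(1)] that(2) by (auto simp: limitin_def)
  show "eventually (\<lambda>s. t s \<in> range \<phi>) Fl" using ev[of UNIV] by simp
  show "((\<lambda>s. inv \<phi> (t s)) \<longlongrightarrow> w) Fl"
  proof (rule topological_tendstoI)
    fix W :: "complex set" assume "open W" "w \<in> W"
    from ev[OF this] show "eventually (\<lambda>s. inv \<phi> (t s) \<in> W) Fl"
      by eventually_elim (use inj_sphere_param[OF \<phi>] in auto)
  qed
qed

lemma local_coordinate_simple_zero:
  assumes g: "local_coordinate (\<phi> w) U g" and \<phi>: "\<phi> \<in> sphere_params"
  shows "\<exists>D. D \<noteq> 0 \<and> ((\<lambda>z. g (\<phi> z) / (z - w)) \<longlongrightarrow> D) (at w)"
proof -
  have "open (\<phi> -` U)" "(g \<circ> \<phi>) holomorphic_on (\<phi> -` U)" "w \<in> \<phi> -` U" "g (\<phi> w) = 0"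
    using g \<phi> open_sphere_param_preimage[OF \<phi>] by (auto simp: local_coordinate_def)
  moreover have "inj_on (g \<circ> \<phi>) (\<phi> -` U)"
    using g inj_sphere_param[OF \<phi>] by (auto simp: local_coordinate_def inj_on_def)
  ultimately have "deriv (g \<circ> \<phi>) w \<noteq> 0" "((g \<circ> \<phi>) has_field_derivative deriv (g \<circ> \<phi>) w) (at w)"
    by (metis holomorphic_injective_imp_regular, metis holomorphic_derivI)
  then show ?thesis
    using \<open>g (\<phi> w) = 0\<close> by (auto simp: has_field_derivative_iff)
qed

text \<open>Two local coordinates at the same point vanish to the first order there, because injective
  holomorphic functions have nonzero derivative; so their ratio has a finite nonzero limit. The limit
  is taken along an arbitrary map \<open>t\<close> into the sphere that converges to \<open>y\<close> without taking the value
  \<open>y\<close>: this lets the lemma apply both to \<open>t\<close> and to \<open>f \<circ> t\<close>.\<close>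

lemma local_coordinates_comparable:
  assumes g: "local_coordinate y U g" and g': "local_coordinate y U' g'"
  shows "\<exists>L. L \<noteq> 0 \<and> (\<forall>(t :: complex \<Rightarrow> complex option) Fl. limitin riemann_sphere t y Fl \<longrightarrow>
    eventually (\<lambda>s. t s \<noteq> y) Fl \<longrightarrow> ((\<lambda>s. g' (t s) / g (t s)) \<longlongrightarrow> L) Fl)"
proof -
  obtain \<phi> w where \<phi>: "\<phi> \<in> sphere_params" and y: "y = \<phi> w"
    using in_range_sphere_param[of y] by auto
  obtain D D' where D: "D \<noteq> 0" "((\<lambda>z. g (\<phi> z) / (z - w)) \<longlongrightarrow> D) (at w)"
    and D': "D' \<noteq> 0" "((\<lambda>z. g' (\<phi> z) / (z - w)) \<longlongrightarrow> D') (at w)"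
    using local_coordinate_simple_zero[OF g[unfolded y] \<phi>]
      local_coordinate_simple_zero[OF g'[unfolded y] \<phi>] by metis
  have "((\<lambda>z. g' (\<phi> z) / (z - w) / (g (\<phi> z) / (z - w))) \<longlongrightarrow> D' / D) (at w)"
    by (intro tendsto_divide D D')
  moreover have "eventually (\<lambda>z. g' (\<phi> z) / (z - w) / (g (\<phi> z) / (z - w)) = g' (\<phi> z) / g (\<phi> z)) (at w)"
    by (simp add: eventually_at_filter)
  ultimately have ratio: "((\<lambda>z. g' (\<phi> z) / g (\<phi> z)) \<longlongrightarrow> D' / D) (at w)"
    by (rule Lim_transform_eventually)
  have "((\<lambda>s. g' (t s) / g (t s)) \<longlongrightarrow> D' / D) Fl"
    if t: "limitin riemann_sphere t y Fl" "eventually (\<lambda>s. t s \<noteq> y) Fl"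
    for t :: "complex \<Rightarrow> complex option" and Fl
  proof -
    note lim = limitin_sphere_param[OF \<phi> t(1)[unfolded y]]
    have "eventually (\<lambda>s. inv \<phi> (t s) \<noteq> w) Fl"
      using lim(1) t(2) by eventually_elim (auto simp: y f_inv_into_f)
    then have "filterlim (\<lambda>s. inv \<phi> (t s)) (at w) Fl"
      using lim(2) by (simp add: filterlim_at)
    from filterlim_compose[OF ratio this]
    have "((\<lambda>s. g' (\<phi> (inv \<phi> (t s))) / g (\<phi> (inv \<phi> (t s)))) \<longlongrightarrow> D' / D) Fl" .
    moreover have "eventually (\<lambda>s. g' (\<phi> (inv \<phi> (t s))) / g (\<phi> (inv \<phi> (t s))) = g' (t s) / g (t s)) Fl"
      using lim(1) by eventually_elim (simp add: f_inv_into_f)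
    ultimately show ?thesis by (rule Lim_transform_eventually)
  qed
  then show ?thesis using D D' by (intro exI[of _ "D' / D"]) auto
qed

text \<open>The ramification index is an order of vanishing in \<^emph>\<open>any\<close> pair of local coordinates, not only in the
  pair that brings \<open>f\<close> into the form \<open>z \<mapsto> z\<^sup>e\<close>: changing the coordinates multiplies the quotient
  by ratios with nonzero limits.\<close>

lemma ramification_index_limit:
  assumes f: "continuous_map riemann_sphere riemann_sphere f"
    and e: "has_ramification_index f y e"
    and g: "local_coordinate y U g" and h: "local_coordinate (f y) V h"
  shows "\<exists>L. L \<noteq> 0 \<and> (\<forall>(t :: complex \<Rightarrow> complex option) Fl. limitin riemann_sphere t y Fl \<longrightarrow>
    eventually (\<lambda>s. t s \<noteq> y) Fl \<longrightarrow> ((\<lambda>s. h (f (t s)) / g (t s) ^ e) \<longlongrightarrow> L) Fl)"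
proof -
  obtain U0 g0 V0 h0 where g0: "local_coordinate y U0 g0" and h0: "local_coordinate (f y) V0 h0"
    and fU: "f ` U0 \<subseteq> V0" and normal: "\<And>x. x \<in> U0 \<Longrightarrow> h0 (f x) = g0 x ^ e"
    using e unfolding has_ramification_index_def by metis
  obtain L1 where L1: "L1 \<noteq> 0" "\<And>(t :: complex \<Rightarrow> complex option) Fl. limitin riemann_sphere t (f y) Fl \<Longrightarrow>
    eventually (\<lambda>s. t s \<noteq> f y) Fl \<Longrightarrow> ((\<lambda>s. h (t s) / h0 (t s)) \<longlongrightarrow> L1) Fl"
    using local_coordinates_comparable[OF h0 h] by auto
  obtain L2 where L2: "L2 \<noteq> 0" "\<And>(t :: complex \<Rightarrow> complex option) Fl. limitin riemann_sphere t y Fl \<Longrightarrow>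
    eventually (\<lambda>s. t s \<noteq> y) Fl \<Longrightarrow> ((\<lambda>s. g0 (t s) / g (t s)) \<longlongrightarrow> L2) Fl"
    using local_coordinates_comparable[OF g g0] by auto
  have "((\<lambda>s. h (f (t s)) / g (t s) ^ e) \<longlongrightarrow> L1 * L2 ^ e) Fl"
    if t: "limitin riemann_sphere t y Fl" "eventually (\<lambda>s. t s \<noteq> y) Fl"
    for t :: "complex \<Rightarrow> complex option" and Fl
  proof -
    have "eventually (\<lambda>s. t s \<in> U0) Fl"
      using t(1) g0 by (auto simp: limitin_def local_coordinate_def)
    \<comment> \<open>The inequality also keeps \<open>f (t s)\<close> away from \<open>f y\<close>, as the comparison on the target side requires.\<close>
    with t(2) have ev: "eventually (\<lambda>s. h0 (f (t s)) = g0 (t s) ^ e \<and> g0 (t s) \<noteq> 0) Fl"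
    proof eventually_elim
      case (elim s)
      then have "g0 (t s) \<noteq> g0 y"
        using g0 by (auto simp: local_coordinate_def inj_on_def)
      then show ?case using elim normal g0 by (auto simp: local_coordinate_def)
    qed
    have ft: "limitin riemann_sphere (\<lambda>s. f (t s)) (f y) Fl"
      using continuous_map_limit[OF f t(1)] by (simp add: o_def)
    have "eventually (\<lambda>s. f (t s) \<noteq> f y) Fl"
      using ev by eventually_elim (use h0 in \<open>auto simp: local_coordinate_def\<close>)
    then have "((\<lambda>s. h (f (t s)) / h0 (f (t s)) * (g0 (t s) / g (t s)) ^ e) \<longlongrightarrow> L1 * L2 ^ e) Fl"
      by (intro tendsto_mult tendsto_power L1 L2 ft t)
    moreover have "eventually (\<lambda>s. h (f (t s)) / h0 (f (t s)) * (g0 (t s) / g (t s)) ^ e =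
        h (f (t s)) / g (t s) ^ e) Fl"
      using ev by eventually_elim (simp add: power_divide)
    ultimately show ?thesis by (rule Lim_transform_eventually)
  qed
  then show ?thesis using L1(1) L2(1) by (intro exI[of _ "L1 * L2 ^ e"]) auto
qed

section \<open>Moebius transformations and holomorphic functions on the sphere\<close>

text \<open>Homogeneous coordinates \<open>[hom1 y : hom2 y]\<close> with \<open>\<infinity> = [1 : 0]\<close> and \<open>z = [z : 1]\<close>. They make the
  formulas for Moebius transformations uniform, without separate treatment of the point at
  infinity.\<close>

definition hom1 :: "complex option \<Rightarrow> complex" where
  "hom1 y = (case y of None \<Rightarrow> 1 | Some z \<Rightarrow> z)"

definition hom2 :: "complex option \<Rightarrow> complex" where
  "hom2 y = (case y of None \<Rightarrow> 0 | Some z \<Rightarrow> 1)"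

definition bracket :: "complex option \<Rightarrow> complex option \<Rightarrow> complex" where
  "bracket y p = hom1 y * hom2 p - hom2 y * hom1 p"

definition of_hom :: "complex \<Rightarrow> complex \<Rightarrow> complex option" where
  "of_hom a b = (if b = 0 then None else Some (a / b))"

text \<open>The Moebius transformation with a zero at \<open>p\<close> and a pole at \<open>q\<close>; at \<open>q\<close> itself it takes the
  default value \<open>0\<close> of a division by zero.\<close>

definition moebius_coord :: "complex option \<Rightarrow> complex option \<Rightarrow> complex option \<Rightarrow> complex" where
  "moebius_coord p q y = bracket y p / bracket y q"

text \<open>The inverse of \<open>moebius_coord s x\<close>, found by solving \<open>bracket y s = z * bracket y x\<close> for the
  homogeneous coordinates of \<open>y\<close>. It parametrizes the sphere minus \<open>x\<close> by the plane, so it moves \<open>x\<close>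
  to infinity.\<close>

definition moebius_param :: "complex option \<Rightarrow> complex option \<Rightarrow> complex \<Rightarrow> complex option" where
  "moebius_param s x z = of_hom (hom1 s - z * hom1 x) (hom2 s - z * hom2 x)"

lemma bracket_eq_0_iff [simp]: "bracket y p = 0 \<longleftrightarrow> y = p"
  by (auto simp: bracket_def hom1_def hom2_def split: option.splits)

text \<open>The Pluecker relation for four points of the projective line.\<close>

lemma bracket_exchange:
  "bracket y p * bracket y' q - bracket y' p * bracket y q = bracket y y' * bracket p q"
  by (simp add: bracket_def) (simp add: algebra_simps)

lemma of_hom_homogeneous:
  assumes "a \<noteq> 0 \<or> b \<noteq> 0"
  shows "\<exists>\<mu>. \<mu> \<noteq> 0 \<and> a = \<mu> * hom1 (of_hom a b) \<and> b = \<mu> * hom2 (of_hom a b)"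
proof (cases "b = 0")
  case True
  then show ?thesis using assms by (intro exI[of _ a]) (simp add: of_hom_def hom1_def hom2_def)
next
  case False
  then show ?thesis by (intro exI[of _ b]) (simp add: of_hom_def hom1_def hom2_def)
qed

lemma moebius_param_hom_nonzero:
  assumes "s \<noteq> x"
  shows "hom1 s - z * hom1 x \<noteq> 0 \<or> hom2 s - z * hom2 x \<noteq> 0"
  using assms by (auto simp: hom1_def hom2_def split: option.splits)

lemma moebius_coord_zero [simp]: "moebius_coord p q p = 0"
  by (simp add: moebius_coord_def)

text \<open>Holds at every \<open>y\<close>, the poles included, by the conventions for division by zero.\<close>

lemma moebius_coord_inverse: "inverse (moebius_coord p q y) = moebius_coord q p y"
  by (simp add: moebius_coord_def)

lemma inj_on_moebius_coord:
  assumes "p \<noteq> q"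
  shows "inj_on (moebius_coord p q) (- {q})"
proof (rule inj_onI)
  fix y y' assume "y \<in> - {q}" "y' \<in> - {q}" "moebius_coord p q y = moebius_coord p q y'"
  then have "bracket y p * bracket y' q - bracket y' p * bracket y q = 0"
    by (simp add: moebius_coord_def frac_eq_eq)
  then show "y = y'" using assms by (simp add: bracket_exchange)
qed

lemma
  assumes "s \<noteq> x"
  shows moebius_param_neq: "moebius_param s x z \<noteq> x"
    and moebius_coord_param: "moebius_coord s x (moebius_param s x z) = z"
proof -
  define y where "y = moebius_param s x z"
  obtain \<mu> where \<mu>: "\<mu> \<noteq> 0" "hom1 s - z * hom1 x = \<mu> * hom1 y" "hom2 s - z * hom2 x = \<mu> * hom2 y"
    using of_hom_homogeneous[OF moebius_param_hom_nonzero[OF assms]]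
    unfolding y_def moebius_param_def by metis
  have "\<mu> * bracket y p = (\<mu> * hom1 y) * hom2 p - (\<mu> * hom2 y) * hom1 p" for p
    by (simp add: bracket_def algebra_simps)
  then have "\<mu> * bracket y s = z * bracket s x" "\<mu> * bracket y x = bracket s x"
    by (simp_all add: \<mu>(2,3)[symmetric]) (simp_all add: bracket_def algebra_simps)
  moreover have "bracket s x \<noteq> 0" using assms by simp
  ultimately have "\<mu> * bracket y x \<noteq> 0" "\<mu> * bracket y s = z * (\<mu> * bracket y x)" by auto
  then show "moebius_param s x z \<noteq> x" "moebius_coord s x (moebius_param s x z) = z"
    using \<mu>(1) by (auto simp: moebius_coord_def simp flip: y_def) 
qed

lemma moebius_param_coord:
  assumes "s \<noteq> x" "y \<noteq> x"
  shows "moebius_param s x (moebius_coord s x y) = y"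
  using inj_onD[OF inj_on_moebius_coord[OF assms(1)]] moebius_coord_param[OF assms(1)]
    moebius_param_neq[OF assms(1)] assms(2) by auto

lemma inj_moebius_param: "s \<noteq> x \<Longrightarrow> inj (moebius_param s x)"
  by (metis injI moebius_coord_param)

lemma moebius_param_inverse:
  assumes "z \<noteq> 0"
  shows "moebius_param x s (inverse z) = moebius_param s x z"
proof -
  have "hom1 x - inverse z * hom1 s = - inverse z * (hom1 s - z * hom1 x)"
    "hom2 x - inverse z * hom2 s = - inverse z * (hom2 s - z * hom2 x)"
    using assms by (auto simp: field_simps)
  then show ?thesis using assms unfolding moebius_param_def of_hom_def by simp
qed

lemma moebius_coord_holomorphic:
  assumes "\<phi> \<in> sphere_params"
  shows "(moebius_coord p q \<circ> \<phi>) holomorphic_on (\<phi> -` (- {q}))"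
proof (cases "\<phi> = Some")
  case True
  have "(\<lambda>z. (z * hom2 p - hom1 p) / (z * hom2 q - hom1 q)) holomorphic_on (\<phi> -` (- {q}))"
    using bracket_eq_0_iff[of _ q] True
    by (intro holomorphic_intros) (auto simp: bracket_def hom1_def hom2_def split: option.splits)
  then show ?thesis
    by (rule holomorphic_transform) (auto simp: True moebius_coord_def bracket_def hom1_def hom2_def)
next
  case False
  then have \<phi>: "\<phi> = infinity_param" using assms by (simp add: sphere_params_def)
  \<comment> \<open>In the chart at infinity the homogeneous coordinates are \<open>[1 : w]\<close>, up to a factor independent of \<open>p\<close>.\<close>
  have br: "\<exists>c. c \<noteq> 0 \<and> (\<forall>p. hom2 p - w * hom1 p = c * bracket (infinity_param w) p)" for w
    by (rule exI[of _ "if w = 0 then 1 else w"])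
      (auto simp: infinity_param_def bracket_def hom1_def hom2_def right_diff_distrib split: option.splits)
  have "(\<lambda>w. (hom2 p - w * hom1 p) / (hom2 q - w * hom1 q)) holomorphic_on (\<phi> -` (- {q}))"
  proof (intro holomorphic_intros)
    show "hom2 q - w * hom1 q \<noteq> 0" if "w \<in> \<phi> -` (- {q})" for w
    proof -
      obtain c where "c \<noteq> 0" "hom2 q - w * hom1 q = c * bracket (infinity_param w) q"
        using br[of w] by blast
      then show ?thesis using that \<phi> by simp
    qed
  qed
  then show ?thesis
  proof (rule holomorphic_transform)
    fix w
    obtain c where "c \<noteq> 0" "\<And>p. hom2 p - w * hom1 p = c * bracket (infinity_param w) p"
      using br[of w] by blast
    then show "(hom2 p - w * hom1 p) / (hom2 q - w * hom1 q) = (moebius_coord p q \<circ> \<phi>) w"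
      by (simp add: \<phi> moebius_coord_def)
  qed
qed

lemma local_coordinate_moebius_coord:
  assumes "p \<noteq> q" "r \<noteq> q"
  shows "local_coordinate r (- {q}) (\<lambda>y. moebius_coord p q y - moebius_coord p q r)"
proof -
  have "((\<lambda>y. moebius_coord p q y - moebius_coord p q r) \<circ> \<phi>) holomorphic_on (\<phi> -` (- {q}))"
    if "\<phi> \<in> sphere_params" for \<phi>
    using holomorphic_on_diff[OF moebius_coord_holomorphic[OF that, of p q] holomorphic_on_const[of "moebius_coord p q r"]]
    by (simp add: o_def)
  then show ?thesis
    using assms inj_on_moebius_coord[OF assms(1)] openin_sphere_delete
    by (auto simp: local_coordinate_def inj_on_def)
qed

lemma local_coordinate_moebius_coord_zero:
  "p \<noteq> q \<Longrightarrow> local_coordinate p (- {q}) (moebius_coord p q)"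
  using local_coordinate_moebius_coord[of p q p] by simp

text \<open>A Moebius parametrization is locally a standard parametrization after a holomorphic function.
  Both its continuity and the holomorphy of its composites come from this.\<close>

lemma moebius_param_cases:
  assumes "s \<noteq> x"
  obtains W1 W2 h1 h2 where "open W1" "open W2" "W1 \<union> W2 = UNIV"
    "h1 holomorphic_on W1" "h2 holomorphic_on W2"
    "\<And>z. z \<in> W1 \<Longrightarrow> moebius_param s x z = Some (h1 z)"
    "\<And>z. z \<in> W2 \<Longrightarrow> moebius_param s x z = infinity_param (h2 z)"
proof
  let ?a = "\<lambda>z. hom1 s - z * hom1 x" and ?b = "\<lambda>z. hom2 s - z * hom2 x"
  show "open {z. ?b z \<noteq> 0}" "open {z. ?a z \<noteq> 0}"
    by (auto intro!: open_Collect_neq continuous_intros)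
  show "{z. ?b z \<noteq> 0} \<union> {z. ?a z \<noteq> 0} = UNIV"
    using moebius_param_hom_nonzero[OF assms] by auto
  show "(\<lambda>z. ?a z / ?b z) holomorphic_on {z. ?b z \<noteq> 0}"
    "(\<lambda>z. ?b z / ?a z) holomorphic_on {z. ?a z \<noteq> 0}"
    by (auto intro!: holomorphic_intros)
qed (auto simp: moebius_param_def of_hom_def infinity_param_def)

lemma open_moebius_param_preimage:
  assumes "s \<noteq> x" "openin riemann_sphere U"
  shows "open (moebius_param s x -` U)"
proof -
  obtain W1 W2 h1 h2 where W: "open W1" "open W2" "W1 \<union> W2 = UNIV"
    "h1 holomorphic_on W1" "h2 holomorphic_on W2"
    "\<And>z. z \<in> W1 \<Longrightarrow> moebius_param s x z = Some (h1 z)"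
    "\<And>z. z \<in> W2 \<Longrightarrow> moebius_param s x z = infinity_param (h2 z)"
    using moebius_param_cases[OF assms(1)] by blast
  have "moebius_param s x -` U = (W1 \<inter> h1 -` (Some -` U)) \<union> (W2 \<inter> h2 -` (infinity_param -` U))"
    using W(3,6,7) by (auto simp: set_eq_iff) metis+
  moreover have "open (W1 \<inter> h1 -` (Some -` U))" "open (W2 \<inter> h2 -` (infinity_param -` U))"
    using assms(2) W by (auto intro!: continuous_open_preimage holomorphic_on_imp_continuous_on
        simp: openin_riemann_sphere_iff)
  ultimately show ?thesis by auto
qed

lemma moebius_param_limit:
  assumes "s \<noteq> x"
  shows "limitin riemann_sphere (moebius_param s x) (moebius_param s x z) (at z)"
  unfolding limitin_def
proof safe
  fix U assume "openin riemann_sphere U" "moebius_param s x z \<in> U"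
  then have "eventually (\<lambda>w. w \<in> moebius_param s x -` U) (at z)"
    using open_moebius_param_preimage[OF assms] by (intro eventually_at_in_open') auto
  then show "eventually (\<lambda>w. moebius_param s x w \<in> U) (at z)" by simp
qed simp

text \<open>Exchanging \<open>s\<close> and \<open>x\<close> amounts to inverting \<open>z\<close>, which reduces infinity to the continuity
  at \<open>0\<close>.\<close>

lemma moebius_param_limit_at_infinity:
  assumes "s \<noteq> x"
  shows "limitin riemann_sphere (moebius_param s x) x at_infinity"
  unfolding limitin_def
proof safe
  fix U assume U: "openin riemann_sphere U" "x \<in> U"
  have "moebius_param x s 0 = x"
    by (cases x) (auto simp: moebius_param_def of_hom_def hom1_def hom2_def)
  then have "eventually (\<lambda>w. moebius_param x s w \<in> U) (at 0)"
    using U moebius_param_limit[of x s 0] assms by (auto simp: limitin_def)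
  then have "eventually (\<lambda>z. moebius_param x s (inverse z) \<in> U) at_infinity"
    by (simp add: at_to_infinity eventually_filtermap)
  with eventually_at_infinity_notin_finite[of "{0}", simplified]
  show "eventually (\<lambda>z. moebius_param s x z \<in> U) at_infinity"
    by eventually_elim (simp add: moebius_param_inverse)
qed simp

definition sphere_holomorphic_on :: "(complex option \<Rightarrow> complex) \<Rightarrow> complex option set \<Rightarrow> bool" where
  "sphere_holomorphic_on u V \<longleftrightarrow> openin riemann_sphere V \<and>
     (\<forall>\<phi>\<in>sphere_params. (u \<circ> \<phi>) holomorphic_on (\<phi> -` V))"

text \<open>The domain is covered by the open sets on which \<open>f\<close> takes values in one fixed chart, where
  the local expression of \<open>f\<close> is holomorphic by definition.\<close>

lemma sphere_holomorphic_on_compose: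
  assumes f: "holomorphic_sphere_map f" and u: "sphere_holomorphic_on u V"
  shows "sphere_holomorphic_on (u \<circ> f) (f -` V)"
  unfolding sphere_holomorphic_on_def
proof safe
  have cont: "continuous_map riemann_sphere riemann_sphere f"
    using f by (simp add: holomorphic_sphere_map_def)
  have pre: "openin riemann_sphere (f -` W)" if "openin riemann_sphere W" for W
    using openin_continuous_map_preimage[OF cont that] by (simp add: vimage_def)
  have V: "openin riemann_sphere V" using u by (simp add: sphere_holomorphic_on_def)
  show "openin riemann_sphere (f -` V)" by (rule pre[OF V])
  fix \<phi> :: "complex \<Rightarrow> complex option" assume \<phi>: "\<phi> \<in> sphere_params"
  define S where "S \<psi> = \<phi> -` f -` V \<inter> \<phi> -` f -` range \<psi>" for \<psi> :: "complex \<Rightarrow> complex option"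
  have "(u \<circ> f \<circ> \<phi>) holomorphic_on (\<Union>\<psi>\<in>sphere_params. S \<psi>)"
  proof (rule holomorphic_on_UN_open)
    fix \<psi> :: "complex \<Rightarrow> complex option" assume \<psi>: "\<psi> \<in> sphere_params"
    show "open (S \<psi>)"
      unfolding S_def using openin_sphere_param_image[OF \<psi>, of UNIV]
      by (intro open_Int open_sphere_param_preimage[OF \<phi>] pre V) auto
    have "(inv \<psi> \<circ> f \<circ> \<phi>) holomorphic_on S \<psi>"
      using f \<phi> \<psi> unfolding holomorphic_sphere_map_def
      by (rule_tac holomorphic_on_subset[of _ "{z. f (\<phi> z) \<in> range \<psi>}"]) (auto simp: S_def)
    moreover have "(u \<circ> \<psi>) holomorphic_on (\<psi> -` V)"
      using u \<psi> by (simp add: sphere_holomorphic_on_def)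
    moreover have "(inv \<psi> \<circ> f \<circ> \<phi>) ` S \<psi> \<subseteq> \<psi> -` V"
      by (auto simp: S_def f_inv_into_f)
    ultimately have "(u \<circ> \<psi> \<circ> (inv \<psi> \<circ> f \<circ> \<phi>)) holomorphic_on S \<psi>"
      by (rule holomorphic_on_compose_gen)
    then show "(u \<circ> f \<circ> \<phi>) holomorphic_on S \<psi>"
      by (rule holomorphic_transform) (auto simp: S_def f_inv_into_f)
  qed
  moreover have "(\<Union>\<psi>\<in>sphere_params. S \<psi>) = \<phi> -` f -` V"
    using in_range_sphere_param by (auto simp: S_def)
  ultimately show "(u \<circ> f \<circ> \<phi>) holomorphic_on (\<phi> -` f -` V)" by simp
qed

lemma sphere_holomorphic_on_moebius_param:
  assumes "s \<noteq> x" and u: "sphere_holomorphic_on u V"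
  shows "(u \<circ> moebius_param s x) holomorphic_on (moebius_param s x -` V)"
proof -
  obtain W1 W2 h1 h2 where W: "open W1" "open W2" "W1 \<union> W2 = UNIV"
    "h1 holomorphic_on W1" "h2 holomorphic_on W2"
    "\<And>z. z \<in> W1 \<Longrightarrow> moebius_param s x z = Some (h1 z)"
    "\<And>z. z \<in> W2 \<Longrightarrow> moebius_param s x z = infinity_param (h2 z)"
    using moebius_param_cases[OF assms(1)] by blast
  let ?S = "moebius_param s x -` V"
  have "openin riemann_sphere V" using u by (simp add: sphere_holomorphic_on_def)
  then have S: "open ?S" by (rule open_moebius_param_preimage[OF assms(1)])
  have piece: "(u \<circ> moebius_param s x) holomorphic_on (?S \<inter> W)"
    if "\<phi> \<in> sphere_params" "h holomorphic_on W" "\<And>z. z \<in> W \<Longrightarrow> moebius_param s x z = \<phi> (h z)"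
    for \<phi> h W
  proof (rule holomorphic_transform)
    show "((u \<circ> \<phi>) \<circ> h) holomorphic_on (?S \<inter> W)"
      using u that by (intro holomorphic_on_compose_gen[where t = "\<phi> -` V"])
        (auto simp: sphere_holomorphic_on_def intro: holomorphic_on_subset)
  qed (use that(3) in auto)
  have "(u \<circ> moebius_param s x) holomorphic_on ((?S \<inter> W1) \<union> (?S \<inter> W2))"
    using S W piece[of Some h1 W1] piece[of infinity_param h2 W2]
    by (intro holomorphic_on_Un) (auto simp: sphere_params_def)
  moreover have "(?S \<inter> W1) \<union> (?S \<inter> W2) = ?S" using W(3) by auto
  ultimately show ?thesis by simp
qed

section \<open>Even fibres bound the remaining ramification\<close>

text \<open>Turns the enumeration of a fibre and of its indices into a function on the fibre, so that sums
  over lists become sums over sets.\<close>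

lemma list_all2_imp_index_function:
  assumes "list_all2 R qs es" "distinct qs"
  shows "\<exists>E. (\<forall>q\<in>set qs. R q (E q) \<and> E q \<in> set es) \<and> (\<Sum>q\<in>set qs. E q) = sum_list es"
  using assms
proof (induction rule: list_all2_induct)
  case Nil
  then show ?case by simp
next
  case (Cons q qs e es)
  then obtain E where E: "\<And>p. p \<in> set qs \<Longrightarrow> R p (E p) \<and> E p \<in> set es"
    "(\<Sum>p\<in>set qs. E p) = sum_list es" by auto
  have "(\<Sum>p\<in>set qs. (E(q := e)) p) = (\<Sum>p\<in>set qs. E p)"
    using Cons.prems by (intro sum.cong) auto
  then show ?case
    using E Cons.hyps Cons.prems by (intro exI[of _ "E(q := e)"]) auto
qed

text \<open>The map factors as a Moebius transformation after the square of a map \<open>g\<close> of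
  degree \<open>k\<close>, and squaring is unramified away from \<open>0\<close> and \<open>\<infinity>\<close>, so away from the fibres over \<open>p\<close>
  and \<open>q\<close> the ramification indices of \<open>f\<close> are those of \<open>g\<close>, hence at most \<open>k\<close>. Here \<open>x\<close> is moved to
  infinity, where its index becomes a rate of decay.\<close>

lemma ramification_index_in_complement:
  assumes f: "holomorphic_sphere_map f" and "p \<noteq> q"
    and P: "distinct ps" "set ps = f -` {p}" "list_all2 (has_ramification_index f) ps es"
      "\<forall>e\<in>set es. even e" "sum_list es = 2 * k"
    and Q: "distinct qs" "set qs = f -` {q}" "list_all2 (has_ramification_index f) qs es'"
      "\<forall>e\<in>set es'. even e" "sum_list es' = 2 * k"
    and x: "has_ramification_index f x e" "f x \<noteq> p" "f x \<noteq> q"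
  shows "e \<le> k"
proof (cases "e = 0")
  case False
  define s :: "complex option" where "s = (if x = None then Some 0 else None)"
  have sx: "s \<noteq> x" by (auto simp: s_def)
  define \<psi> where "\<psi> = moebius_param s x"
  have \<psi>x: "\<psi> z \<noteq> x" for z using moebius_param_neq[OF sx] by (simp add: \<psi>_def)
  have inj: "inj \<psi>" using inj_moebius_param[OF sx] by (simp add: \<psi>_def)
  have coord: "moebius_coord s x (\<psi> z) = z" for z
    using moebius_coord_param[OF sx] by (simp add: \<psi>_def)
  have lim: "limitin riemann_sphere \<psi> (\<psi> z) (at z)" for z
    using moebius_param_limit[OF sx] by (simp add: \<psi>_def)
  have neq: "eventually (\<lambda>w. \<psi> w \<noteq> \<psi> z) (at z)" for z
    using inj by (simp add: eventually_at_filter inj_eq)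
  have cont: "continuous_map riemann_sphere riemann_sphere f"
    using f by (simp add: holomorphic_sphere_map_def)
  define F where "F = moebius_coord p q \<circ> f \<circ> \<psi>"
  define c where "c = moebius_coord p q (f x)"
  have "c \<noteq> 0" using x by (simp add: c_def moebius_coord_def)

  \<comment> \<open>The fibres over \<open>p\<close> and \<open>q\<close> play symmetric roles: \<open>(r, r')\<close> stands for \<open>(p, q)\<close> and for \<open>(q, p)\<close>,
    and \<open>m\<close> is half the ramification index.\<close>
  have fibre: "\<exists>m. finite (\<psi> -` f -` {r}) \<and> (\<Sum>a\<in>\<psi> -` f -` {r}. m a) = k \<and>
      (\<forall>a\<in>\<psi> -` f -` {r}. \<exists>L. L \<noteq> 0 \<and>
         ((\<lambda>z. moebius_coord r r' (f (\<psi> z)) / (z - a) ^ (2 * m a)) \<longlongrightarrow> L) (at a))"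
    if rs: "distinct rs" "set rs = f -` {r}" "list_all2 (has_ramification_index f) rs is"
      "\<forall>i\<in>set is. even i" "sum_list is = 2 * k" and r: "f x \<noteq> r" "r \<noteq> r'"
    for r r' rs "is"
  proof -
    obtain E where E: "\<And>y. y \<in> set rs \<Longrightarrow> has_ramification_index f y (E y)"
      "\<And>y. y \<in> set rs \<Longrightarrow> even (E y)" "(\<Sum>y\<in>set rs. E y) = 2 * k"
      using list_all2_imp_index_function[OF rs(3,1)] rs(4,5) by metis
    define m where "m a = E (\<psi> a) div 2" for a
    have m: "E (\<psi> a) = 2 * m a" if "a \<in> \<psi> -` f -` {r}" for a
      using E(2)[of "\<psi> a"] that rs(2) by (auto simp: m_def)
    have "finite (\<psi> -` f -` {r})"
      unfolding rs(2)[symmetric] by (intro finite_vimageI inj) simp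
    moreover have "(\<Sum>a\<in>\<psi> -` f -` {r}. m a) = k"
    proof -
      have "y \<in> range \<psi>" if "y \<in> set rs" for y
      proof -
        \<comment> \<open>This is where \<open>x\<close> must not lie over \<open>r\<close>: the whole fibre stays visible in the plane.\<close>
        have "y \<noteq> x" using that r rs(2) by auto
        then show ?thesis using moebius_param_coord[OF sx] by (metis \<psi>_def rangeI)
      qed
      then have "set rs = \<psi> ` (\<psi> -` f -` {r})"
        unfolding rs(2)[symmetric] by auto
      moreover have "(\<Sum>y\<in>\<psi> ` S. E y) = (\<Sum>a\<in>S. E (\<psi> a))" for S
        using sum.reindex[OF inj_on_subset[OF inj subset_UNIV], of E S] by (simp only: o_def)
      ultimately have "(\<Sum>y\<in>set rs. E y) = (\<Sum>a\<in>\<psi> -` f -` {r}. E (\<psi> a))"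
        by metis
      also have "\<dots> = 2 * (\<Sum>a\<in>\<psi> -` f -` {r}. m a)"
        by (simp add: m sum_distrib_left)
      finally show ?thesis using E(3) by simp
    qed
    moreover have "\<exists>L. L \<noteq> 0 \<and>
         ((\<lambda>z. moebius_coord r r' (f (\<psi> z)) / (z - a) ^ (2 * m a)) \<longlongrightarrow> L) (at a)"
      if a: "a \<in> \<psi> -` f -` {r}" for a
    proof -
      have "has_ramification_index f (\<psi> a) (2 * m a)"
        using E(1)[of "\<psi> a"] a rs(2) by (simp add: m)
      moreover have "local_coordinate (\<psi> a) (- {x}) (\<lambda>y. moebius_coord s x y - a)"
        using local_coordinate_moebius_coord[OF sx \<psi>x] by (simp add: coord)
      moreover have "local_coordinate (f (\<psi> a)) (- {r'}) (moebius_coord r r')"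
        using local_coordinate_moebius_coord_zero[OF r(2)] a by simp
      ultimately obtain L where L: "L \<noteq> 0"
        "\<And>(t :: complex \<Rightarrow> complex option) Fl. limitin riemann_sphere t (\<psi> a) Fl \<Longrightarrow>
          eventually (\<lambda>s. t s \<noteq> \<psi> a) Fl \<Longrightarrow>
          ((\<lambda>z. moebius_coord r r' (f (t z)) / (moebius_coord s x (t z) - a) ^ (2 * m a)) \<longlongrightarrow> L) Fl"
        using ramification_index_limit[OF cont] by blast
      show ?thesis
        using L(1) L(2)[OF lim neq] by (auto simp: coord)
    qed
    ultimately show ?thesis by blast
  qed

  obtain m where m: "finite (\<psi> -` f -` {p})" "(\<Sum>a\<in>\<psi> -` f -` {p}. m a) = k"
    "\<And>a. a \<in> \<psi> -` f -` {p} \<Longrightarrow> \<exists>L. L \<noteq> 0 \<and>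
       ((\<lambda>z. moebius_coord p q (f (\<psi> z)) / (z - a) ^ (2 * m a)) \<longlongrightarrow> L) (at a)"
    using fibre[OF P x(2) \<open>p \<noteq> q\<close>] by blast
  obtain n where n: "finite (\<psi> -` f -` {q})" "(\<Sum>a\<in>\<psi> -` f -` {q}. n a) = k"
    "\<And>a. a \<in> \<psi> -` f -` {q} \<Longrightarrow> \<exists>L. L \<noteq> 0 \<and>
       ((\<lambda>z. moebius_coord q p (f (\<psi> z)) / (z - a) ^ (2 * n a)) \<longlongrightarrow> L) (at a)"
    using fibre[OF Q x(3) \<open>p \<noteq> q\<close>[symmetric]] by blast

  \<comment> \<open>The coordinate \<open>moebius_coord x s\<close> centred at \<open>x\<close> is \<open>1 / z\<close> in the parameter \<open>z\<close>.\<close>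
  have "\<exists>L. L \<noteq> 0 \<and> ((\<lambda>z. (F z - c) * z ^ e) \<longlongrightarrow> L) at_infinity"
  proof -
    obtain L where L: "L \<noteq> 0"
      "\<And>(t :: complex \<Rightarrow> complex option) Fl. limitin riemann_sphere t x Fl \<Longrightarrow>
        eventually (\<lambda>s. t s \<noteq> x) Fl \<Longrightarrow>
        ((\<lambda>z. (moebius_coord p q (f (t z)) - c) / (moebius_coord x s (t z)) ^ e) \<longlongrightarrow> L) Fl"
      using ramification_index_limit[OF cont x(1) local_coordinate_moebius_coord_zero[OF sx[symmetric]]
          local_coordinate_moebius_coord[OF \<open>p \<noteq> q\<close> x(3)]] unfolding c_def by blast
    have "moebius_coord x s (\<psi> z) = inverse z" for z
      by (metis coord moebius_coord_inverse)
    moreover have "limitin riemann_sphere \<psi> x at_infinity"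
      using moebius_param_limit_at_infinity[OF sx] by (simp add: \<psi>_def)
    ultimately have "((\<lambda>z. (F z - c) * z ^ e) \<longlongrightarrow> L) at_infinity"
      using L(2)[of \<psi> at_infinity] \<psi>x by (simp add: F_def power_inverse divide_inverse)
    then show ?thesis using L(1) by blast
  qed
  then obtain L where L: "L \<noteq> 0" "((\<lambda>z. (F z - c) * z ^ e) \<longlongrightarrow> L) at_infinity" by blast
  have "(F \<longlongrightarrow> c) at_infinity"
  proof -
    have "((\<lambda>z. (F z - c) * z ^ e * inverse z ^ e + c) \<longlongrightarrow> L * 0 ^ e + c) at_infinity"
      by (intro tendsto_intros L tendsto_inverse_0)
    moreover have "eventually (\<lambda>z. (F z - c) * z ^ e * inverse z ^ e + c = F z) at_infinity"
      using eventually_at_infinity_notin_finite[of "{0}", simplified]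
      by eventually_elim (simp add: power_inverse mult.assoc)
    ultimately have "(F \<longlongrightarrow> L * 0 ^ e + c) at_infinity" by (rule Lim_transform_eventually)
    then show ?thesis using False by (simp add: zero_power)
  qed
  have "sphere_holomorphic_on (moebius_coord p q) (- {q})"
    using moebius_coord_holomorphic openin_sphere_delete by (auto simp: sphere_holomorphic_on_def)
  then have "F holomorphic_on (\<psi> -` f -` (- {q}))"
    unfolding F_def \<psi>_def
    by (intro sphere_holomorphic_on_moebius_param sphere_holomorphic_on_compose sx f)
  then have hol: "F holomorphic_on - (\<psi> -` f -` {p} \<union> \<psi> -` f -` {q})"
    by (rule holomorphic_on_subset) auto
  have "F z = c * (divisor_poly (\<psi> -` f -` {p}) m z / divisor_poly (\<psi> -` f -` {q}) n z)\<^sup>2"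
    if "z \<notin> \<psi> -` f -` {p} \<union> \<psi> -` f -` {q}" for z
  proof (rule square_of_rational_function[OF m(1) n(1) m(2) n(2) hol _ _ \<open>(F \<longlongrightarrow> c) at_infinity\<close> that])
    show "\<exists>l. ((\<lambda>z. F z / (z - a) ^ (2 * m a)) \<longlongrightarrow> l) (at a)" if "a \<in> \<psi> -` f -` {p}" for a
      using m(3)[OF that] by (auto simp: F_def)
    show "\<exists>l. ((\<lambda>z. F z * (z - b) ^ (2 * n b)) \<longlongrightarrow> l) (at b)" if b: "b \<in> \<psi> -` f -` {q}" for b
    proof -
      obtain l where l: "l \<noteq> 0"
        "((\<lambda>z. moebius_coord q p (f (\<psi> z)) / (z - b) ^ (2 * n b)) \<longlongrightarrow> l) (at b)"
        using n(3)[OF b] by blast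
      \<comment> \<open>The poles of \<open>F\<close> are the zeros of its reciprocal, which is \<open>f\<close> read in a coordinate centred at \<open>q\<close>.\<close>
      have "F z = inverse (moebius_coord q p (f (\<psi> z)))" for z
        by (simp add: F_def moebius_coord_inverse)
      then show ?thesis
        using tendsto_inverse[OF l(2,1)] by (auto simp: divide_inverse)
    qed
  qed
  then show ?thesis
    by (rule square_of_rational_function_order_at_infinity[OF m(1) n(1) m(2) n(2) _ \<open>c \<noteq> 0\<close> L])
qed simp

lemma realizes_ramification_index_le:
  assumes f: "realizes f d D" and ijl: "i < length D" "j < length D" "l < length D" "i \<noteq> j" "l \<noteq> i" "l \<noteq> j"
    and even: "\<forall>e\<in>set (D ! i). even e" "\<forall>e\<in>set (D ! j). even e"
    and sum: "sum_list (D ! i) = 2 * k" "sum_list (D ! j) = 2 * k"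
    and e: "e \<in> set (D ! l)"
  shows "e \<le> k"
proof -
  obtain ps where ps: "length ps = length D" "distinct ps"
    "\<And>i. i < length D \<Longrightarrow> \<exists>qs. distinct qs \<and> set qs = f -` {ps ! i} \<and>
       list_all2 (has_ramification_index f) qs (D ! i)"
    using f unfolding realizes_def by blast
  have hol: "holomorphic_sphere_map f"
    using f by (simp add: realizes_def branched_cover_def)
  obtain qi qj ql where q: "distinct qi" "set qi = f -` {ps ! i}" "list_all2 (has_ramification_index f) qi (D ! i)"
    "distinct qj" "set qj = f -` {ps ! j}" "list_all2 (has_ramification_index f) qj (D ! j)"
    "set ql = f -` {ps ! l}" "list_all2 (has_ramification_index f) ql (D ! l)"
    using ps(3) ijl(1-3) by metis
  obtain n where n: "n < length (D ! l)" "D ! l ! n = e"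
    using e by (auto simp: in_set_conv_nth)
  then have "has_ramification_index f (ql ! n) e" "ql ! n \<in> f -` {ps ! l}"
    using list_all2_nthD2[OF q(8) n(1)] list_all2_lengthD[OF q(8)] q(7) nth_mem by auto
  moreover have "ps ! i \<noteq> ps ! j" "ps ! l \<noteq> ps ! i" "ps ! l \<noteq> ps ! j"
    using ijl ps(1,2) by (simp_all add: nth_eq_iff_index_eq)
  ultimately show ?thesis
    using ramification_index_in_complement[OF hol _ q(1-3) even(1) sum(1) q(4-6) even(2) sum(2)] by auto
qed

theorem proposition1:
  fixes d k :: nat
  assumes "d = 2 * k" and "k \<ge> 2"
  shows "(\<forall>k1 k2 :: nat. k1 > 0 \<and> k2 > 0 \<and> k1 + k2 = 2 * k \<and> k1 \<noteq> k2 \<longrightarrow>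
            exceptional d [[k1, k2], replicate k 2, replicate k 2]) \<and>
         (k \<ge> 3 \<longrightarrow>
           (\<forall>j1 j2 :: nat. j1 + j2 = k \<and> j1 \<noteq> j2 \<and> j1 \<ge> 1 \<and> j2 \<ge> 1 \<longrightarrow>
              exceptional d [replicate k 2,
                             replicate j1 2 @ [2 * k - 2 * j1],
                             replicate j2 2 @ [2 * k - 2 * j2]]))"
proof (intro conjI allI impI; (elim conjE)?)
  fix k1 k2 :: nat
  assume k: "k1 > 0" "k2 > 0" "k1 + k2 = 2 * k" "k1 \<noteq> k2"
  let ?D = "[[k1, k2], replicate k 2, replicate k 2]"
  have "int k1 + int k2 = 2 * int k" using k(3) by linarith
  then have "candidate_branch_datum d ?D"
    using k assms by (auto simp: candidate_branch_datum_def sum_list_replicate)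
  moreover have False if "realizes f d ?D" for f
  proof -
    have "k1 \<le> k" "k2 \<le> k"
      by (rule realizes_ramification_index_le[OF that, of 1 2 0]; simp add: sum_list_replicate)+
    then show False using k by simp
  qed
  ultimately show "exceptional d ?D" by (auto simp: exceptional_def)
next
  fix j1 j2 :: nat
  assume "k \<ge> 3" and j: "j1 + j2 = k" "j1 \<noteq> j2" "j1 \<ge> 1" "j2 \<ge> 1"
  let ?D = "[replicate k 2, replicate j1 2 @ [2 * k - 2 * j1], replicate j2 2 @ [2 * k - 2 * j2]]"
  \<comment> \<open>Since \<open>j1 + j2 = k\<close>, the last parts \<open>2 k - 2 j1\<close> and \<open>2 k - 2 j2\<close> are \<open>2 j2\<close> and \<open>2 j1\<close>: every
    part of the datum is even, and the bound applies to each pair of fibres.\<close>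
  have D: "?D = [replicate k 2, replicate j1 2 @ [2 * j2], replicate j2 2 @ [2 * j1]]"
    using j(1) by auto
  have "candidate_branch_datum d ?D"
    unfolding D using j assms
    by (auto simp: candidate_branch_datum_def sum_list_replicate)
  moreover have False if "realizes f d ?D" for f
  proof -
    have "2 * j1 \<le> k"
      by (rule realizes_ramification_index_le[OF that[unfolded D], of 0 1 2];
          use j(1) in \<open>simp add: sum_list_replicate\<close>)
    moreover have "2 * j2 \<le> k"
      by (rule realizes_ramification_index_le[OF that[unfolded D], of 0 2 1];
          use j(1) in \<open>simp add: sum_list_replicate\<close>)
    ultimately show False using j by simp
  qed
  ultimately show "exceptional d ?D" by (auto simp: exceptional_def)
qed

end
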